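(* Let $0\le s\in\mathbb{R}$, let $E_s:H^s(\Omega)\to L_2(\Omega)$ denote the embedding operator, let $X_m=\operatorname{span}\{\phi_1,\dots,\phi_m\}\subset H^s(\Omega)$ and $Y_n=\operatorname{span}\{\psi_1,\dots,\psi_n\}\subset L_2(\Omega)$ with $\{\phi_k\}_{k=1}^m$ and $\{\psi_k\}_{k=1}^n$ each linearly independent, let $P_m$ and $Q_n$ be the orthogonal projectors onto $X_m$ (in $H^s(\Omega)$) and $Y_n$ (in $L_2(\Omega)$), respectively, and let $$E_{m,n}^s:=Q_nE_sP_m,\qquad(E_{m,n}^s)^*=P_mE_s^*Q_n.$$ Furthermore, let $u\in L_2(\Omega)$ and define $$\mathbf{H}_{X_m}:=\big(\langle\phi_j,\phi_k\rangle_{H^s(\Omega)}\big)_{k,j=1}^{m,m},\quad\mathbf{H}_{Y_n}:=\big(\langle\psi_j,\psi_k\rangle_{L_2(\Omega)}\big)_{k,j=1}^{n,n},\quad\mathbf{u}:=\big(\langle u,\psi_j\rangle_{L_2(\Omega)}\big)_{j=1}^n,\quad\mathbf{M}_{m,n}:=\big(\langle\psi_j,\phi_k\rangle_{L_2(\Omega)}\big)_{k,j=1}^{m,n}.$$ Then the element $(E_{m,n}^s)^*u$ is given by $$(E_{m,n}^s)^*u=\sum_{k=1}^mz_k\phi_k,\qquad\text{where}\qquad\mathbf{z}=(z_k)_{k=1}^m:=\mathbf{H}_{X_m}^{-1}\mathbf{M}_{m,n}\mathbf{H}_{Y_n}^{-1}\mathbf{u}.$$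
   Context: $\Omega\subseteq\mathbb{R}^N$ is nonempty and open. $L_2(\Omega)$ is the complex Lebesgue space with $\langle u,v\rangle_{L_2(\Omega)}=\int_\Omega u\overline v\,dx$. For integer $s\ge0$, $H^s(\Omega)$ is the space of $u\in L_2(\Omega)$ with weak derivatives $D^\alpha u\in L_2(\Omega)$, $0\le|\alpha|\le s$, with standard norm $(\sum_{0\le|\alpha|\le s}\|D^\alpha u\|^2_{L_2(\Omega)})^{1/2}$; for non-integer $s$ only $\Omega=\mathbb{R}^N$ is considered and $H^s(\mathbb{R}^N)$ is the space of $u\in L_2(\mathbb{R}^N)$ with finite norm $\|(1+4\pi^2|\cdot|^2)^{s/2}\mathcal{F}u\|_{L_2(\mathbb{R}^N)}$, $(\mathcal{F}u)(\xi)=\int e^{-2\pi i\xi\cdot x}u(x)\,dx$. $\langle\cdot,\cdot\rangle_{H^s(\Omega)}$ may be any fixed inner product inducing a norm equivalent to the standard one. The embedding is $E_su:=u$ and its adjoint $E_s^*:L_2(\Omega)\to H^s(\Omega)$ is defined by $\langle E_s^*u,v\rangle_{H^s(\Omega)}=\langle u,v\rangle_{L_2(\Omega)}$ for all $u\in L_2(\Omega)$, $v\in H^s(\Omega)$. In the matrices, the first index $k$ is the row index and the second index $j$ the column index. *)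

theory Defs
  imports "HOL-Analysis.Analysis"
begin

text \<open>Elements of the function spaces are represented by functions on the whole of
  \<open>real^'N\<close> whose values outside \<open>\<Omega>\<close> are irrelevant; equality in
  the spaces is \<open>ae_eq \<Omega>\<close>.\<close>

definition ae_eq :: "(real^'N) set \<Rightarrow> (real^'N \<Rightarrow> complex) \<Rightarrow> (real^'N \<Rightarrow> complex) \<Rightarrow> bool" where
  "ae_eq \<Omega> u v \<longleftrightarrow> (AE x in lebesgue_on \<Omega>. u x = v x)"

definition L2_space :: "(real^'N) set \<Rightarrow> (real^'N \<Rightarrow> complex) set" where
  "L2_space \<Omega> = {u. u \<in> borel_measurable (lebesgue_on \<Omega>) \<and>
                    integrable (lebesgue_on \<Omega>) (\<lambda>x. (cmod (u x))\<^sup>2)}"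

definition L2_inner :: "(real^'N) set \<Rightarrow> (real^'N \<Rightarrow> complex) \<Rightarrow> (real^'N \<Rightarrow> complex) \<Rightarrow> complex" where
  "L2_inner \<Omega> u v = integral\<^sup>L (lebesgue_on \<Omega>) (\<lambda>x. u x * cnj (v x))"

definition L2_norm :: "(real^'N) set \<Rightarrow> (real^'N \<Rightarrow> complex) \<Rightarrow> real" where
  "L2_norm \<Omega> u = sqrt (integral\<^sup>L (lebesgue_on \<Omega>) (\<lambda>x. (cmod (u x))\<^sup>2))"

definition L2_tendsto ::
    "(real^'N) set \<Rightarrow> (nat \<Rightarrow> real^'N \<Rightarrow> complex) \<Rightarrow> (real^'N \<Rightarrow> complex) \<Rightarrow> bool" where
  "L2_tendsto \<Omega> f g \<longleftrightarrow> (\<forall>k. f k \<in> L2_space \<Omega>) \<and> g \<in> L2_space \<Omega> \<and>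
     (\<lambda>k. L2_norm \<Omega> (\<lambda>x. f k x - g x)) \<longlonglongrightarrow> 0"

subsection \<open>Weak derivatives\<close>

definition partial_deriv :: "'N \<Rightarrow> (real^'N \<Rightarrow> complex) \<Rightarrow> real^'N \<Rightarrow> complex" where
  "partial_deriv i f = (\<lambda>x. frechet_derivative f (at x) (axis i 1))"

fun iter_partial :: "'N list \<Rightarrow> (real^'N \<Rightarrow> complex) \<Rightarrow> real^'N \<Rightarrow> complex" where
  "iter_partial [] f = f"
| "iter_partial (i # is) f = partial_deriv i (iter_partial is f)"

text \<open>\<open>C\<^sub>c\<^sup>\<infinity>(\<Omega>)\<close>: a function is smooth iff all its iterated partial derivatives
  are (Frechet) differentiable everywhere.\<close>

definition test_functions :: "(real^'N) set \<Rightarrow> (real^'N \<Rightarrow> complex) set" where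
  "test_functions \<Omega> = {\<phi>. (\<forall>is. iter_partial is \<phi> differentiable_on UNIV) \<and>
     compact (closure {x. \<phi> x \<noteq> 0}) \<and> closure {x. \<phi> x \<noteq> 0} \<subseteq> \<Omega>}"

definition multi_order :: "('N::finite \<Rightarrow> nat) \<Rightarrow> nat" where
  "multi_order \<alpha> = (\<Sum>i\<in>UNIV. \<alpha> i)"

text \<open>The classical derivative \<open>D\<^sup>\<alpha>\<close>; it is only applied to smooth functions, for
  which the order of the differentiations is immaterial.\<close>

definition multi_deriv :: "('N::finite \<Rightarrow> nat) \<Rightarrow> (real^'N \<Rightarrow> complex) \<Rightarrow> real^'N \<Rightarrow> complex" where
  "multi_deriv \<alpha> = iter_partial (SOME is. \<forall>i. count_list is i = \<alpha> i)"

definition is_weak_deriv ::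
    "(real^'N) set \<Rightarrow> ('N::finite \<Rightarrow> nat) \<Rightarrow> (real^'N \<Rightarrow> complex) \<Rightarrow> (real^'N \<Rightarrow> complex) \<Rightarrow> bool" where
  "is_weak_deriv \<Omega> \<alpha> u g \<longleftrightarrow> (\<forall>\<phi>\<in>test_functions \<Omega>.
     integral\<^sup>L (lebesgue_on \<Omega>) (\<lambda>x. u x * multi_deriv \<alpha> \<phi> x) =
     (-1) ^ multi_order \<alpha> * integral\<^sup>L (lebesgue_on \<Omega>) (\<lambda>x. g x * \<phi> x))"

definition weak_deriv ::
    "(real^'N) set \<Rightarrow> ('N::finite \<Rightarrow> nat) \<Rightarrow> (real^'N \<Rightarrow> complex) \<Rightarrow> real^'N \<Rightarrow> complex" where
  "weak_deriv \<Omega> \<alpha> u = (SOME g. g \<in> L2_space \<Omega> \<and> is_weak_deriv \<Omega> \<alpha> u g)"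

subsection \<open>Fourier transform on \<open>L\<^sub>2\<close>\<close>

definition fourier :: "(real^'N \<Rightarrow> complex) \<Rightarrow> real^'N \<Rightarrow> complex" where
  "fourier u \<xi> = integral\<^sup>L lebesgue (\<lambda>x. exp (- (2 * of_real pi * \<i> * of_real (\<xi> \<bullet> x))) * u x)"

text \<open>For \<open>u\<close> in \<open>L\<^sub>2\<close> the integral need not converge; as usual, the transform is then the
  \<open>L\<^sub>2\<close>-limit of the transforms of the truncations of \<open>u\<close> to balls (which are integrable).
  By Plancherel's theorem this limit always exists, and it agrees with \<open>fourier u\<close> almost
  everywhere if \<open>u\<close> is also integrable.\<close>

definition is_L2_fourier :: "(real^'N \<Rightarrow> complex) \<Rightarrow> (real^'N \<Rightarrow> complex) \<Rightarrow> bool" where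
  "is_L2_fourier u g \<longleftrightarrow>
     L2_tendsto UNIV (\<lambda>k. fourier (\<lambda>x. if norm x \<le> real k then u x else 0)) g"

definition L2_fourier :: "(real^'N \<Rightarrow> complex) \<Rightarrow> real^'N \<Rightarrow> complex" where
  "L2_fourier u = (SOME g. is_L2_fourier u g)"

definition bessel_weight :: "real \<Rightarrow> (real^'N \<Rightarrow> complex) \<Rightarrow> real^'N \<Rightarrow> complex" where
  "bessel_weight s g \<xi> = of_real ((1 + 4 * pi\<^sup>2 * (norm \<xi>)\<^sup>2) powr (s / 2)) * g \<xi>"

subsection \<open>Sobolev spaces\<close>

text \<open>For \<open>s\<close> not a natural number the definitions are only meaningful for \<open>\<Omega> = UNIV\<close>.\<close>

definition sobolev_space :: "(real^'N) set \<Rightarrow> real \<Rightarrow> (real^'N \<Rightarrow> complex) set" where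
  "sobolev_space \<Omega> s =
     (if s \<in> \<nat>
      then {u \<in> L2_space \<Omega>. \<forall>\<alpha>. real (multi_order \<alpha>) \<le> s \<longrightarrow>
              (\<exists>g\<in>L2_space \<Omega>. is_weak_deriv \<Omega> \<alpha> u g)}
      else {u \<in> L2_space UNIV. \<exists>g. is_L2_fourier u g \<and> bessel_weight s g \<in> L2_space UNIV})"

definition sobolev_norm :: "(real^'N) set \<Rightarrow> real \<Rightarrow> (real^'N \<Rightarrow> complex) \<Rightarrow> real" where
  "sobolev_norm \<Omega> s u =
     (if s \<in> \<nat>
      then sqrt (\<Sum>\<alpha> | real (multi_order \<alpha>) \<le> s. (L2_norm \<Omega> (weak_deriv \<Omega> \<alpha> u))\<^sup>2)
      else L2_norm UNIV (bessel_weight s (L2_fourier u)))"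

text \<open>Inner products on a space \<open>V\<close> of functions modulo equality almost everywhere on
  \<open>\<Omega>\<close>; the first condition says that \<open>ip\<close> is well defined on equivalence classes.\<close>

definition is_inner_product ::
    "(real^'N) set \<Rightarrow> (real^'N \<Rightarrow> complex) set \<Rightarrow>
     ((real^'N \<Rightarrow> complex) \<Rightarrow> (real^'N \<Rightarrow> complex) \<Rightarrow> complex) \<Rightarrow> bool" where
  "is_inner_product \<Omega> V ip \<longleftrightarrow>
     (\<forall>u\<in>V. \<forall>u'\<in>V. \<forall>v\<in>V. ae_eq \<Omega> u u' \<longrightarrow> ip u v = ip u' v) \<and>
     (\<forall>u\<in>V. \<forall>v\<in>V. \<forall>w\<in>V. ip (\<lambda>x. u x + v x) w = ip u w + ip v w) \<and>
     (\<forall>c. \<forall>u\<in>V. \<forall>v\<in>V. ip (\<lambda>x. c * u x) v = c * ip u v) \<and>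
     (\<forall>u\<in>V. \<forall>v\<in>V. ip v u = cnj (ip u v)) \<and>
     (\<forall>u\<in>V. 0 \<le> Re (ip u u)) \<and>
     (\<forall>u\<in>V. ip u u = 0 \<longrightarrow> ae_eq \<Omega> u (\<lambda>x. 0))"

definition is_sobolev_inner ::
    "(real^'N) set \<Rightarrow> real \<Rightarrow>
     ((real^'N \<Rightarrow> complex) \<Rightarrow> (real^'N \<Rightarrow> complex) \<Rightarrow> complex) \<Rightarrow> bool" where
  "is_sobolev_inner \<Omega> s ip \<longleftrightarrow> is_inner_product \<Omega> (sobolev_space \<Omega> s) ip \<and>
     (\<exists>c C. 0 < c \<and> (\<forall>u\<in>sobolev_space \<Omega> s.
        c * sobolev_norm \<Omega> s u \<le> sqrt (Re (ip u u)) \<and>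
        sqrt (Re (ip u u)) \<le> C * sobolev_norm \<Omega> s u))"

definition sobolev_embedding :: "(real^'N \<Rightarrow> complex) \<Rightarrow> real^'N \<Rightarrow> complex" where
  "sobolev_embedding u = u"

subsection \<open>Spans, projectors and adjoints\<close>

definition lin_indep :: "(real^'N) set \<Rightarrow> ('i::finite \<Rightarrow> real^'N \<Rightarrow> complex) \<Rightarrow> bool" where
  "lin_indep \<Omega> \<phi> \<longleftrightarrow>
     (\<forall>c. ae_eq \<Omega> (\<lambda>x. \<Sum>k\<in>UNIV. c k * \<phi> k x) (\<lambda>x. 0) \<longrightarrow> (\<forall>k. c k = 0))"

definition fun_span ::
    "(real^'N) set \<Rightarrow> (real^'N \<Rightarrow> complex) set \<Rightarrow> ('i::finite \<Rightarrow> real^'N \<Rightarrow> complex) \<Rightarrow>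
     (real^'N \<Rightarrow> complex) set" where
  "fun_span \<Omega> V \<phi> = {v \<in> V. \<exists>c. ae_eq \<Omega> v (\<lambda>x. \<Sum>k\<in>UNIV. c k * \<phi> k x)}"

text \<open>\<open>P\<close> is the orthogonal projector of \<open>(V, ip)\<close> onto \<open>X\<close>.\<close>

definition is_orth_proj ::
    "(real^'N \<Rightarrow> complex) set \<Rightarrow> ((real^'N \<Rightarrow> complex) \<Rightarrow> (real^'N \<Rightarrow> complex) \<Rightarrow> complex) \<Rightarrow>
     (real^'N \<Rightarrow> complex) set \<Rightarrow> ((real^'N \<Rightarrow> complex) \<Rightarrow> real^'N \<Rightarrow> complex) \<Rightarrow> bool" where
  "is_orth_proj V ip X P \<longleftrightarrow>
     (\<forall>u\<in>V. P u \<in> X \<and> (\<forall>v\<in>X. ip (\<lambda>x. u x - P u x) v = 0))"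

text \<open>\<open>T'\<close> is the adjoint of \<open>T : H\<^sup>s(\<Omega>) \<rightarrow> L\<^sub>2(\<Omega>)\<close>,
  where \<open>H\<^sup>s(\<Omega>)\<close> carries the inner product \<open>ip\<close>.\<close>

definition is_adjoint ::
    "(real^'N) set \<Rightarrow> real \<Rightarrow> ((real^'N \<Rightarrow> complex) \<Rightarrow> (real^'N \<Rightarrow> complex) \<Rightarrow> complex) \<Rightarrow>
     ((real^'N \<Rightarrow> complex) \<Rightarrow> real^'N \<Rightarrow> complex) \<Rightarrow>
     ((real^'N \<Rightarrow> complex) \<Rightarrow> real^'N \<Rightarrow> complex) \<Rightarrow> bool" where
  "is_adjoint \<Omega> s ip T T' \<longleftrightarrow>
     (\<forall>u\<in>L2_space \<Omega>. T' u \<in> sobolev_space \<Omega> s \<and>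
        (\<forall>v\<in>sobolev_space \<Omega> s. ip (T' u) v = L2_inner \<Omega> u (T v)))"

end

theory Submission
  imports Defs
begin

text \<open>
  Write \<open>w = (E\<^sub>m\<^sub>,\<^sub>n)\<^sup>*u = P E\<^sup>* Q u\<close>. As \<open>w\<close> lies in the span of the \<open>\<phi>\<^sub>k\<close> and \<open>Q u\<close> in the span of
  the \<open>\<psi>\<^sub>j\<close>, there are coefficient vectors \<open>c\<close> and \<open>d\<close> with \<open>w = \<Sum> c\<^sub>k \<phi>\<^sub>k\<close> and
  \<open>Q u = \<Sum> d\<^sub>j \<psi>\<^sub>j\<close>. The normal equations of the two projections (lemma
  \<open>orth_proj_normal_equations\<close>) read
  \<open>H\<^sub>Y d = (\<langle>u, \<psi>\<^sub>j\<rangle>)\<^sub>j\<close> and \<open>H\<^sub>X c = (\<langle>E\<^sup>* Q u, \<phi>\<^sub>k\<rangle>)\<^sub>k\<close>, and by the defining property of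
  \<open>E\<^sup>*\<close> the right-hand side of the latter is \<open>(\<langle>Q u, \<phi>\<^sub>k\<rangle>)\<^sub>k = M d\<close>. Gram matrices of linearly
  independent families are invertible (lemma \<open>invertible_Gram\<close>), so \<open>c = z\<close>. That \<open>P E\<^sup>* Q\<close> is
  the adjoint of \<open>Q E P\<close> is the self-adjointness of orthogonal projectors.

  All of this is linear algebra in a complex inner product space of functions modulo equality
  almost everywhere. What remains is that \<open>L\<^sub>2(\<Omega>)\<close> and \<open>H\<^sup>s(\<Omega>)\<close> are such spaces, that is,
  closed under linear combinations. For \<open>H\<^sup>s\<close> this rests on the additivity of the integrals which
  define weak derivatives and the Fourier transform of truncations; these converge because
  the product of two \<open>L\<^sub>2\<close> functions is integrable.
\<close>

section \<open>Inner product spaces of functions modulo null sets\<close>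

text \<open>A linear space \<open>V\<close> of functions with an inner product \<open>ip\<close> on the classes of
  functions that agree almost everywhere on \<open>\<Omega>\<close>. The set \<open>V\<close> need not contain every
  function that agrees almost everywhere with one of its members.\<close>

locale function_inner_space =
  fixes \<Omega> :: "(real^'N) set" and V :: "(real^'N \<Rightarrow> complex) set"
    and ip :: "(real^'N \<Rightarrow> complex) \<Rightarrow> (real^'N \<Rightarrow> complex) \<Rightarrow> complex"
  assumes zero_mem: "(\<lambda>x. 0) \<in> V"
    and add_mem: "\<And>u v. u \<in> V \<Longrightarrow> v \<in> V \<Longrightarrow> (\<lambda>x. u x + v x) \<in> V"
    and scale_mem: "\<And>c u. u \<in> V \<Longrightarrow> (\<lambda>x. c * u x) \<in> V"
    and inner: "is_inner_product \<Omega> V ip"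
begin

lemma ip_cong: "u \<in> V \<Longrightarrow> u' \<in> V \<Longrightarrow> v \<in> V \<Longrightarrow> ae_eq \<Omega> u u' \<Longrightarrow> ip u v = ip u' v"
  and ip_add: "u \<in> V \<Longrightarrow> v \<in> V \<Longrightarrow> w \<in> V \<Longrightarrow> ip (\<lambda>x. u x + v x) w = ip u w + ip v w"
  and ip_scale: "u \<in> V \<Longrightarrow> v \<in> V \<Longrightarrow> ip (\<lambda>x. c * u x) v = c * ip u v"
  and ip_cnj: "u \<in> V \<Longrightarrow> v \<in> V \<Longrightarrow> ip v u = cnj (ip u v)"
  and ip_definite: "u \<in> V \<Longrightarrow> ip u u = 0 \<Longrightarrow> ae_eq \<Omega> u (\<lambda>x. 0)"
  using inner unfolding is_inner_product_def by blast+

lemma ip_zero: "v \<in> V \<Longrightarrow> ip (\<lambda>x. 0) v = 0"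
  using ip_scale[OF zero_mem, of v 0] by simp

lemma diff_mem:
  assumes "u \<in> V" "v \<in> V"
  shows "(\<lambda>x. u x - v x) \<in> V"
  using add_mem[OF assms(1) scale_mem[OF assms(2), of "-1"]] by simp

lemma ip_diff:
  assumes "u \<in> V" "v \<in> V" "w \<in> V"
  shows "ip (\<lambda>x. u x - v x) w = ip u w - ip v w"
  using ip_add[OF assms(1) scale_mem[OF assms(2), of "-1"] assms(3)]
    ip_scale[OF assms(2,3), of "-1"] by simp

lemma lincomb_mem:
  assumes "finite I" "\<And>k. f k \<in> V"
  shows "(\<lambda>x. \<Sum>k\<in>I. c k * f k x) \<in> V"
  using assms(1)
proof (induction I)
  case empty
  then show ?case by (simp add: zero_mem)
next
  case (insert k I)
  then show ?case
    using add_mem[OF scale_mem[OF assms(2), of "c k" k] insert.IH] by simp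
qed

lemma ip_lincomb:
  assumes "finite I" "\<And>k. f k \<in> V" "v \<in> V"
  shows "ip (\<lambda>x. \<Sum>k\<in>I. c k * f k x) v = (\<Sum>k\<in>I. c k * ip (f k) v)"
  using assms(1)
proof (induction I)
  case empty
  then show ?case by (simp add: ip_zero assms(3))
next
  case (insert k I)
  then show ?case
    using ip_add[OF scale_mem[OF assms(2), of "c k" k] lincomb_mem[OF insert.hyps(1) assms(2)] assms(3)]
    by (simp add: ip_scale assms(2,3))
qed

lemma fun_span_generator:
  assumes "\<And>k. f k \<in> V"
  shows "f k \<in> fun_span \<Omega> V f"
proof -
  have "f k x = (\<Sum>j\<in>UNIV. (if j = k then 1 else 0) * f j x)" for x
    using sum.delta[of UNIV k "\<lambda>j. f j x"] by (simp add: if_distrib[of "\<lambda>a. a * _"] cong: if_cong)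
  then have "ae_eq \<Omega> (f k) (\<lambda>x. \<Sum>j\<in>UNIV. (if j = k then 1 else 0) * f j x)"
    unfolding ae_eq_def by (intro AE_I2) blast
  then show ?thesis
    unfolding fun_span_def using assms by auto
qed

text \<open>The Gram matrix has trivial kernel: if \<open>H c = 0\<close> for the Gram matrix \<open>H\<close>, then
  \<open>\<parallel>\<Sum> c\<^sub>k f\<^sub>k\<parallel>\<^sup>2 = c\<^sup>* H c = 0\<close>, and so \<open>c = 0\<close> by linear independence.\<close>

lemma invertible_Gram:
  fixes f :: "'i::finite \<Rightarrow> real^'N \<Rightarrow> complex"
  assumes f: "\<And>k. f k \<in> V" and indep: "lin_indep \<Omega> f"
  shows "invertible ((\<chi> k j. ip (f j) (f k)) :: complex^'i^'i)" (is "invertible ?H")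
proof -
  have "c = 0" if "?H *v c = 0" for c :: "complex^'i"
  proof -
    define w where "w = (\<lambda>x. \<Sum>k\<in>UNIV. c $ k * f k x)"
    have w: "w \<in> V"
      unfolding w_def by (intro lincomb_mem f) simp
    have orth: "ip w (f k) = 0" for k
    proof -
      have "ip w (f k) = (\<Sum>j\<in>UNIV. c $ j * ip (f j) (f k))"
        unfolding w_def by (intro ip_lincomb f) simp
      also have "\<dots> = (?H *v c) $ k"
        by (simp add: matrix_vector_mult_def mult.commute)
      finally show ?thesis using that by simp
    qed
    have "ip w w = (\<Sum>k\<in>UNIV. c $ k * ip (f k) w)"
      by (subst (1) w_def) (intro ip_lincomb f w, simp)
    also have "\<dots> = 0"
      using ip_cnj[OF w f] orth by simp
    finally have "ae_eq \<Omega> w (\<lambda>x. 0)"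
      using ip_definite[OF w] by simp
    then have "\<forall>k. c $ k = 0"
      using indep unfolding lin_indep_def w_def by blast
    then show "c = 0" by (simp add: vec_eq_iff)
  qed
  then show ?thesis
    by (metis invertible_left_inverse matrix_left_invertible_ker)
qed

lemma orth_proj_mem:
  assumes "is_orth_proj V ip (fun_span \<Omega> V f) P" "u \<in> V"
  shows "P u \<in> fun_span \<Omega> V f" "P u \<in> V"
  using assms unfolding is_orth_proj_def fun_span_def by auto

lemma orth_proj_ip:
  assumes P: "is_orth_proj V ip (fun_span \<Omega> V f) P" and u: "u \<in> V"
    and v: "v \<in> fun_span \<Omega> V f"
  shows "ip (P u) v = ip u v"
proof -
  have "v \<in> V" using v unfolding fun_span_def by auto
  moreover have "ip (\<lambda>x. u x - P u x) v = 0"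
    using P u v unfolding is_orth_proj_def by blast
  ultimately show ?thesis
    using ip_diff[OF u orth_proj_mem(2)[OF P u]] by simp
qed

lemma orth_proj_selfadjoint:
  assumes P: "is_orth_proj V ip (fun_span \<Omega> V f) P" and u: "u \<in> V" and v: "v \<in> V"
  shows "ip (P u) v = ip u (P v)"
proof -
  note mem = orth_proj_mem[OF P]
  have "ip (P u) v = cnj (ip v (P u))"
    using ip_cnj[OF v mem(2)[OF u]] .
  also have "\<dots> = cnj (ip (P v) (P u))"
    using orth_proj_ip[OF P v mem(1)[OF u]] by simp
  also have "\<dots> = ip (P u) (P v)"
    using ip_cnj[OF mem(2)[OF v] mem(2)[OF u]] by simp
  also have "\<dots> = ip u (P v)"
    by (rule orth_proj_ip[OF P u mem(1)[OF v]])
  finally show ?thesis .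
qed

text \<open>The conditions \<open>\<langle>u - P u, f\<^sub>k\<rangle> = 0\<close> are a linear system for the coefficients of \<open>P u\<close>,
  whose matrix is the Gram matrix.\<close>

lemma orth_proj_normal_equations:
  fixes f :: "'i::finite \<Rightarrow> real^'N \<Rightarrow> complex"
  assumes P: "is_orth_proj V ip (fun_span \<Omega> V f) P" and f: "\<And>k. f k \<in> V" and u: "u \<in> V"
  obtains c :: "complex^'i" where "ae_eq \<Omega> (P u) (\<lambda>x. \<Sum>k\<in>UNIV. c $ k * f k x)"
    and "(\<chi> k j. ip (f j) (f k)) *v c = (\<chi> k. ip u (f k))"
proof -
  obtain c0 where c0: "ae_eq \<Omega> (P u) (\<lambda>x. \<Sum>k\<in>UNIV. c0 k * f k x)"
    using orth_proj_mem(1)[OF P u] unfolding fun_span_def by auto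
  define c :: "complex^'i" where "c = (\<chi> k. c0 k)"
  have c: "ae_eq \<Omega> (P u) (\<lambda>x. \<Sum>k\<in>UNIV. c $ k * f k x)"
    using c0 by (simp add: c_def)
  have "(\<Sum>j\<in>UNIV. c $ j * ip (f j) (f k)) = ip u (f k)" for k
  proof -
    have "(\<Sum>j\<in>UNIV. c $ j * ip (f j) (f k)) = ip (\<lambda>x. \<Sum>j\<in>UNIV. c $ j * f j x) (f k)"
      by (rule sym) (intro ip_lincomb f, simp)
    also have "\<dots> = ip (P u) (f k)"
      by (rule sym, rule ip_cong[OF _ _ f c]) (auto intro: orth_proj_mem(2)[OF P u] lincomb_mem f)
    also have "\<dots> = ip u (f k)"
      by (rule orth_proj_ip[OF P u fun_span_generator]) (rule f)
    finally show ?thesis .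
  qed
  then have "(\<chi> k j. ip (f j) (f k)) *v c = (\<chi> k. ip u (f k))"
    by (simp add: vec_eq_iff matrix_vector_mult_def mult.commute)
  with c show thesis by (rule that)
qed

end

section \<open>The space of square-integrable functions\<close>

lemma cmod_add_squared_le: "(cmod (a + b))\<^sup>2 \<le> 2 * (cmod a)\<^sup>2 + 2 * (cmod b)\<^sup>2"
proof -
  have "(cmod (a + b))\<^sup>2 \<le> (cmod a + cmod b)\<^sup>2"
    by (simp add: norm_triangle_ineq power_mono)
  also have "\<dots> \<le> 2 * (cmod a)\<^sup>2 + 2 * (cmod b)\<^sup>2"
    using zero_le_power2[of "cmod a - cmod b"] by (simp add: power2_sum power2_diff)
  finally show ?thesis .
qed

lemma L2_space_zero: "(\<lambda>x. 0) \<in> L2_space \<Omega>"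
  by (simp add: L2_space_def)

lemma L2_space_scale: "u \<in> L2_space \<Omega> \<Longrightarrow> (\<lambda>x. c * u x) \<in> L2_space \<Omega>"
  by (auto simp: L2_space_def norm_mult power_mult_distrib)

lemma L2_space_add:
  assumes "u \<in> L2_space \<Omega>" "v \<in> L2_space \<Omega>"
  shows "(\<lambda>x. u x + v x) \<in> L2_space \<Omega>"
proof -
  have [measurable]: "u \<in> borel_measurable (lebesgue_on \<Omega>)" "v \<in> borel_measurable (lebesgue_on \<Omega>)"
    and "integrable (lebesgue_on \<Omega>) (\<lambda>x. 2 * (cmod (u x))\<^sup>2 + 2 * (cmod (v x))\<^sup>2)"
    using assms by (auto simp: L2_space_def)
  then have "integrable (lebesgue_on \<Omega>) (\<lambda>x. (cmod (u x + v x))\<^sup>2)"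
    by (elim Bochner_Integration.integrable_bound) (use cmod_add_squared_le in auto)
  then show ?thesis by (simp add: L2_space_def)
qed

lemma L2_space_diff:
  assumes "u \<in> L2_space \<Omega>" "v \<in> L2_space \<Omega>"
  shows "(\<lambda>x. u x - v x) \<in> L2_space \<Omega>"
  using L2_space_add[OF assms(1) L2_space_scale[OF assms(2), of "-1"]] by simp

lemma L2_space_cnj:
  assumes "u \<in> L2_space \<Omega>"
  shows "(\<lambda>x. cnj (u x)) \<in> L2_space \<Omega>"
proof -
  have "cnj \<in> borel_measurable borel"
    by (intro borel_measurable_continuous_onI continuous_intros)
  then show ?thesis
    using assms by (auto simp: L2_space_def intro: measurable_compose)
qed

lemma L2_mult_integrable:
  assumes "u \<in> L2_space \<Omega>" "v \<in> L2_space \<Omega>"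
  shows "integrable (lebesgue_on \<Omega>) (\<lambda>x. u x * v x)"
proof -
  have [measurable]: "u \<in> borel_measurable (lebesgue_on \<Omega>)" "v \<in> borel_measurable (lebesgue_on \<Omega>)"
    and *: "integrable (lebesgue_on \<Omega>) (\<lambda>x. (cmod (u x))\<^sup>2 + (cmod (v x))\<^sup>2)"
    using assms by (auto simp: L2_space_def)
  have "cmod (a * b) \<le> (cmod a)\<^sup>2 + (cmod b)\<^sup>2" for a b
    using zero_le_power2[of "cmod a - cmod b"] mult_nonneg_nonneg[OF norm_ge_zero[of a] norm_ge_zero[of b]]
    unfolding power2_diff norm_mult mult.assoc by linarith
  with * show ?thesis
    by (elim Bochner_Integration.integrable_bound) auto
qed

lemma is_inner_product_L2:
  fixes \<Omega> :: "(real^'N) set"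
  shows "is_inner_product \<Omega> (L2_space \<Omega>) (L2_inner \<Omega>)"
  unfolding is_inner_product_def
proof (intro conjI ballI allI impI)
  fix u u' v assume "u \<in> L2_space \<Omega>" "u' \<in> L2_space \<Omega>" "v \<in> L2_space \<Omega>" "ae_eq \<Omega> u u'"
  then show "L2_inner \<Omega> u v = L2_inner \<Omega> u' v"
    unfolding L2_inner_def ae_eq_def
    by (intro integral_cong_AE borel_measurable_integrable L2_mult_integrable L2_space_cnj) auto
next
  fix u v w assume "u \<in> L2_space \<Omega>" "v \<in> L2_space \<Omega>" "w \<in> L2_space \<Omega>"
  then show "L2_inner \<Omega> (\<lambda>x. u x + v x) w = L2_inner \<Omega> u w + L2_inner \<Omega> v w"
    unfolding L2_inner_def
    by (simp add: distrib_right Bochner_Integration.integral_add L2_mult_integrable L2_space_cnj)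
next
  fix c u v
  show "L2_inner \<Omega> (\<lambda>x. c * u x) v = c * L2_inner \<Omega> u v"
    unfolding L2_inner_def by (simp add: mult.assoc)
next
  fix u v :: "real^'N \<Rightarrow> complex"
  have "(\<lambda>x. v x * cnj (u x)) = (\<lambda>x. cnj (u x * cnj (v x)))"
    by (simp add: mult.commute)
  then show "L2_inner \<Omega> v u = cnj (L2_inner \<Omega> u v)"
    unfolding L2_inner_def by (simp only: Bochner_Integration.integral_cnj)
next
  fix u
  have norm: "L2_inner \<Omega> u u = of_real (integral\<^sup>L (lebesgue_on \<Omega>) (\<lambda>x. (cmod (u x))\<^sup>2))"
    unfolding L2_inner_def by (simp add: complex_norm_square[symmetric] del: of_real_power)
  show "0 \<le> Re (L2_inner \<Omega> u u)" by (simp add: norm)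
  assume u: "u \<in> L2_space \<Omega>" and "L2_inner \<Omega> u u = 0"
  then have "integral\<^sup>L (lebesgue_on \<Omega>) (\<lambda>x. (cmod (u x))\<^sup>2) = 0"
    using norm by simp
  then have "AE x in lebesgue_on \<Omega>. (cmod (u x))\<^sup>2 = 0"
    using u by (subst (asm) integral_nonneg_eq_0_iff_AE) (auto simp: L2_space_def)
  then show "ae_eq \<Omega> u (\<lambda>x. 0)" by (simp add: ae_eq_def)
qed

lemma function_inner_space_L2: "function_inner_space \<Omega> (L2_space \<Omega>) (L2_inner \<Omega>)"
  by unfold_locales (auto intro: L2_space_zero L2_space_add L2_space_scale is_inner_product_L2)

lemma L2_space_bounded_support:
  assumes \<Omega>: "\<Omega> \<in> sets lebesgue" and f: "f \<in> borel_measurable (lebesgue_on \<Omega>)"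
    and K: "compact K" and supp: "\<And>x. x \<notin> K \<Longrightarrow> f x = 0" and bound: "\<And>x. cmod (f x) \<le> B"
  shows "f \<in> L2_space \<Omega>"
proof -
  have "K \<in> lmeasurable"
    using K by (rule lmeasurable_compact)
  then have "integrable lebesgue (\<lambda>x. indicator K x * B\<^sup>2)"
    by (intro integrable_mult_left) (auto simp: fmeasurable_def)
  then have dom: "integrable (lebesgue_on \<Omega>) (\<lambda>x. indicator K x * B\<^sup>2)"
    using integrable_mult_indicator[OF \<Omega>, of "\<lambda>x. indicator K x * B\<^sup>2"] \<Omega>
    by (subst integrable_restrict_space) auto
  have "integrable (lebesgue_on \<Omega>) (\<lambda>x. (cmod (f x))\<^sup>2)"
  proof (rule Bochner_Integration.integrable_bound[OF dom])
    show "(\<lambda>x. (cmod (f x))\<^sup>2) \<in> borel_measurable (lebesgue_on \<Omega>)"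
      using f by measurable
    show "AE x in lebesgue_on \<Omega>. norm ((cmod (f x))\<^sup>2) \<le> norm (indicator K x * B\<^sup>2)"
      using supp bound by (intro AE_I2) (auto simp: indicator_def intro: power_mono)
  qed
  with f show ?thesis by (simp add: L2_space_def)
qed

section \<open>Linearity of weak derivatives\<close>

lemma partial_deriv_zero_outside:
  assumes K: "closed K" and f: "\<And>x. x \<notin> K \<Longrightarrow> f x = 0" and x: "x \<notin> K"
  shows "partial_deriv i f x = 0"
proof -
  have "(f has_derivative (\<lambda>h. 0)) (at x)"
    by (rule has_derivative_transform_within_open[of "\<lambda>x. 0" _ _ UNIV "- K"]) (use K f x in auto)
  from frechet_derivative_at[OF this] have "frechet_derivative f (at x) = (\<lambda>h. 0)"
    by (rule sym)
  then show ?thesis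
    by (simp add: partial_deriv_def)
qed

lemma iter_partial_zero_outside:
  assumes "closed K" "\<And>x. x \<notin> K \<Longrightarrow> f x = 0" "x \<notin> K"
  shows "iter_partial is f x = 0"
  using assms(3)
  by (induction "is" arbitrary: x) (auto intro: partial_deriv_zero_outside assms(1,2))

text \<open>This holds for every list of differentiations, so it applies to \<open>multi_deriv\<close>, which
  picks an arbitrary list with the prescribed multiplicities.\<close>

lemma iter_partial_test_function_L2:
  assumes \<Omega>: "open \<Omega>" and f: "f \<in> test_functions \<Omega>"
  shows "iter_partial is f \<in> L2_space \<Omega>"
proof -
  define g where "g = iter_partial is f"
  define K where "K = closure {x. f x \<noteq> 0}"
  have K: "compact K" and "g differentiable_on UNIV"
    using f unfolding test_functions_def K_def g_def by auto
  then have cont: "continuous_on UNIV g"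
    by (intro differentiable_imp_continuous_on)
  have supp: "g x = 0" if "x \<notin> K" for x
    unfolding g_def
  proof (rule iter_partial_zero_outside[OF _ _ that])
    show "closed K" using K by (rule compact_imp_closed)
    show "f y = 0" if "y \<notin> K" for y
      using that closure_subset[of "{x. f x \<noteq> 0}"] unfolding K_def by auto
  qed
  have "bounded (g ` K)"
    using compact_continuous_image[OF continuous_on_subset[OF cont] K] compact_imp_bounded by auto
  then obtain B where "B > 0" and "\<And>x. x \<in> K \<Longrightarrow> cmod (g x) \<le> B"
    unfolding bounded_pos by auto
  then have bound: "cmod (g x) \<le> B" for x
    using supp[of x] by (cases "x \<in> K") auto
  have "\<Omega> \<in> sets lebesgue" using \<Omega> by simp
  moreover have "g \<in> borel_measurable (lebesgue_on \<Omega>)"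
    using cont \<Omega> by (intro continuous_imp_measurable_on_sets_lebesgue) (auto intro: continuous_on_subset)
  ultimately have "g \<in> L2_space \<Omega>"
    by (rule L2_space_bounded_support[OF _ _ K supp bound])
  then show ?thesis by (simp only: g_def)
qed

lemma is_weak_deriv_add:
  assumes \<Omega>: "open \<Omega>"
    and mem: "u \<in> L2_space \<Omega>" "v \<in> L2_space \<Omega>" "g \<in> L2_space \<Omega>" "h \<in> L2_space \<Omega>"
    and deriv: "is_weak_deriv \<Omega> \<alpha> u g" "is_weak_deriv \<Omega> \<alpha> v h"
  shows "is_weak_deriv \<Omega> \<alpha> (\<lambda>x. u x + v x) (\<lambda>x. g x + h x)"
  unfolding is_weak_deriv_def
proof
  fix f assume f: "f \<in> test_functions \<Omega>"
  have f2: "multi_deriv \<alpha> f \<in> L2_space \<Omega>" "f \<in> L2_space \<Omega>"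
    using iter_partial_test_function_L2[OF \<Omega> f] iter_partial_test_function_L2[OF \<Omega> f, of "[]"]
    by (auto simp: multi_deriv_def)
  show "integral\<^sup>L (lebesgue_on \<Omega>) (\<lambda>x. (u x + v x) * multi_deriv \<alpha> f x) =
     (-1) ^ multi_order \<alpha> * integral\<^sup>L (lebesgue_on \<Omega>) (\<lambda>x. (g x + h x) * f x)"
    using deriv f
    by (simp add: is_weak_deriv_def distrib_right distrib_left
        Bochner_Integration.integral_add L2_mult_integrable mem f2)
qed

lemma is_weak_deriv_scale:
  "is_weak_deriv \<Omega> \<alpha> u g \<Longrightarrow> is_weak_deriv \<Omega> \<alpha> (\<lambda>x. c * u x) (\<lambda>x. c * g x)"
  by (simp add: is_weak_deriv_def mult.assoc mult.left_commute)

section \<open>Linearity of the Fourier transform\<close>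

text \<open>Convergence stated with squared norms is preserved under sums by the pointwise bound
  \<open>\<bar>a + b\<bar>\<^sup>2 \<le> 2 \<bar>a\<bar>\<^sup>2 + 2 \<bar>b\<bar>\<^sup>2\<close> alone; Minkowski's inequality is not needed.\<close>

lemma L2_tendsto_iff:
  "L2_tendsto \<Omega> f g \<longleftrightarrow> (\<forall>k. f k \<in> L2_space \<Omega>) \<and> g \<in> L2_space \<Omega> \<and>
     (\<lambda>k. integral\<^sup>L (lebesgue_on \<Omega>) (\<lambda>x. (cmod (f k x - g x))\<^sup>2)) \<longlonglongrightarrow> 0"
proof -
  define I where "I k = integral\<^sup>L (lebesgue_on \<Omega>) (\<lambda>x. (cmod (f k x - g x))\<^sup>2)" for k
  have "I k \<ge> 0" for k unfolding I_def by simp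
  then have "(\<lambda>k. sqrt (I k)) \<longlonglongrightarrow> 0 \<longleftrightarrow> I \<longlonglongrightarrow> 0"
    using tendsto_power[of "\<lambda>k. sqrt (I k)" 0 sequentially 2] tendsto_real_sqrt[of I 0 sequentially]
    by auto
  then show ?thesis
    unfolding L2_tendsto_def L2_norm_def I_def by simp
qed

lemma L2_tendsto_add:
  assumes "L2_tendsto \<Omega> f g" "L2_tendsto \<Omega> f' g'"
  shows "L2_tendsto \<Omega> (\<lambda>k x. f k x + f' k x) (\<lambda>x. g x + g' x)"
proof -
  let ?I = "\<lambda>h. integral\<^sup>L (lebesgue_on \<Omega>) (\<lambda>x. (cmod (h x))\<^sup>2)"
  have mem: "f k \<in> L2_space \<Omega>" "g \<in> L2_space \<Omega>" "f' k \<in> L2_space \<Omega>" "g' \<in> L2_space \<Omega>" for k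
    using assms by (auto simp: L2_tendsto_def)
  have le: "?I (\<lambda>x. f k x + f' k x - (g x + g' x))
      \<le> 2 * ?I (\<lambda>x. f k x - g x) + 2 * ?I (\<lambda>x. f' k x - g' x)" (is "?l k \<le> ?r k") for k
  proof -
    have int: "integrable (lebesgue_on \<Omega>) (\<lambda>x. (cmod (f k x - g x))\<^sup>2)"
      "integrable (lebesgue_on \<Omega>) (\<lambda>x. (cmod (f' k x - g' x))\<^sup>2)"
      "integrable (lebesgue_on \<Omega>) (\<lambda>x. (cmod (f k x + f' k x - (g x + g' x)))\<^sup>2)"
      using L2_space_diff[OF mem(1,2)] L2_space_diff[OF mem(3,4)]
        L2_space_diff[OF L2_space_add[OF mem(1,3)] L2_space_add[OF mem(2,4)]]
      by (auto simp: L2_space_def)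
    have "?l k \<le> integral\<^sup>L (lebesgue_on \<Omega>)
        (\<lambda>x. 2 * (cmod (f k x - g x))\<^sup>2 + 2 * (cmod (f' k x - g' x))\<^sup>2)"
    proof (rule integral_mono)
      fix x
      show "(cmod (f k x + f' k x - (g x + g' x)))\<^sup>2
          \<le> 2 * (cmod (f k x - g x))\<^sup>2 + 2 * (cmod (f' k x - g' x))\<^sup>2"
        using cmod_add_squared_le[of "f k x - g x" "f' k x - g' x"] by (simp add: algebra_simps)
    qed (use int in auto)
    also have "\<dots> = ?r k" using int by simp
    finally show ?thesis .
  qed
  have "?r \<longlonglongrightarrow> 2 * 0 + 2 * 0"
    using assms unfolding L2_tendsto_iff by (intro tendsto_intros) auto
  then have r: "?r \<longlonglongrightarrow> 0" by (simp only: mult_zero_right add_0)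
  have "?l \<longlonglongrightarrow> 0"
  proof (rule tendsto_sandwich[OF _ _ tendsto_const r])
    show "\<forall>\<^sub>F k in sequentially. 0 \<le> ?l k" by simp
    show "\<forall>\<^sub>F k in sequentially. ?l k \<le> ?r k" using le by (intro always_eventually allI)
  qed
  then show ?thesis
    unfolding L2_tendsto_iff using mem by (auto intro: L2_space_add)
qed

lemma L2_tendsto_scale:
  assumes "L2_tendsto \<Omega> f g"
  shows "L2_tendsto \<Omega> (\<lambda>k x. c * f k x) (\<lambda>x. c * g x)"
proof -
  have "(\<lambda>k. (cmod c)\<^sup>2 * integral\<^sup>L (lebesgue_on \<Omega>) (\<lambda>x. (cmod (f k x - g x))\<^sup>2)) \<longlonglongrightarrow> (cmod c)\<^sup>2 * 0"
    using assms unfolding L2_tendsto_iff by (intro tendsto_intros) auto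
  then show ?thesis
    using assms unfolding L2_tendsto_iff
    by (auto simp: norm_mult power_mult_distrib simp flip: right_diff_distrib intro: L2_space_scale)
qed

text \<open>The integrand of the Fourier integral of a truncation is the product of \<open>u\<close> with the
  truncated exponential, which is bounded with bounded support.\<close>

lemma fourier_truncation_integrable:
  fixes u :: "real^'N \<Rightarrow> complex"
  assumes u: "u \<in> L2_space UNIV"
  shows "integrable lebesgue (\<lambda>x. exp (- (2 * of_real pi * \<i> * of_real (\<xi> \<bullet> x))) *
      (if norm x \<le> r then u x else 0))"
proof -
  define e :: "real^'N \<Rightarrow> complex"
    where "e x = exp (- (2 * of_real pi * \<i> * of_real (\<xi> \<bullet> x))) * indicator (cball 0 r) x" for x
  have "e \<in> L2_space UNIV"
  proof (rule L2_space_bounded_support[where K = "cball 0 r" and B = 1])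
    show "e \<in> borel_measurable (lebesgue_on UNIV)"
      unfolding e_def lebesgue_on_UNIV_eq
    proof (rule measurable_completion)
      have [measurable]: "cball 0 r \<in> sets (lborel :: (real^'N) measure)"
        by simp
      show "(\<lambda>x::real^'N. exp (- (2 * of_real pi * \<i> * of_real (\<xi> \<bullet> x))) * indicator (cball 0 r) x :: complex)
          \<in> borel_measurable lborel"
        by measurable
    qed
    show "cmod (e x) \<le> 1" for x
      by (simp add: e_def norm_mult indicator_def)
  qed (auto simp: e_def)
  from L2_mult_integrable[OF this u] have "integrable lebesgue (\<lambda>x. e x * u x)"
    by (simp only: lebesgue_on_UNIV_eq)
  also have "(\<lambda>x. e x * u x) = (\<lambda>x. exp (- (2 * of_real pi * \<i> * of_real (\<xi> \<bullet> x))) *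
      (if norm x \<le> r then u x else 0))"
    by (auto simp: e_def indicator_def)
  finally show ?thesis .
qed

lemma is_L2_fourier_add:
  fixes u v :: "real^'N \<Rightarrow> complex"
  assumes mem: "u \<in> L2_space UNIV" "v \<in> L2_space UNIV" and "is_L2_fourier u g" "is_L2_fourier v h"
  shows "is_L2_fourier (\<lambda>x. u x + v x) (\<lambda>x. g x + h x)"
proof -
  have "fourier (\<lambda>x. if norm x \<le> r then u x + v x else 0) = (\<lambda>\<xi>.
      fourier (\<lambda>x. if norm x \<le> r then u x else 0) \<xi> + fourier (\<lambda>x. if norm x \<le> r then v x else 0) \<xi>)"
    for r
    unfolding fourier_def fun_eq_iff
    by (intro allI, subst Bochner_Integration.integral_add[symmetric])
      (auto intro!: fourier_truncation_integrable mem Bochner_Integration.integral_cong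
        simp: distrib_left)
  then show ?thesis
    using L2_tendsto_add[OF assms(3,4)[unfolded is_L2_fourier_def]]
    by (simp only: is_L2_fourier_def)
qed

lemma is_L2_fourier_scale:
  fixes u :: "real^'N \<Rightarrow> complex"
  assumes "is_L2_fourier u g"
  shows "is_L2_fourier (\<lambda>x. c * u x) (\<lambda>x. c * g x)"
proof -
  have "fourier (\<lambda>x. if norm x \<le> r then c * u x else 0) =
      (\<lambda>\<xi>. c * fourier (\<lambda>x. if norm x \<le> r then u x else 0) \<xi>)" for r
    unfolding fourier_def fun_eq_iff
    by (intro allI, subst integral_mult_right_zero[symmetric], rule Bochner_Integration.integral_cong) auto
  then show ?thesis
    using L2_tendsto_scale[OF assms[unfolded is_L2_fourier_def], of c]
    by (simp only: is_L2_fourier_def)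
qed

section \<open>Sobolev spaces as inner product spaces\<close>

lemma sobolev_space_subset_L2:
  assumes "s \<in> \<nat> \<or> \<Omega> = UNIV"
  shows "sobolev_space \<Omega> s \<subseteq> L2_space \<Omega>"
  using assms by (auto simp: sobolev_space_def)

lemma sobolev_space_add:
  assumes \<Omega>: "open \<Omega>" and u: "u \<in> sobolev_space \<Omega> s" and v: "v \<in> sobolev_space \<Omega> s"
  shows "(\<lambda>x. u x + v x) \<in> sobolev_space \<Omega> s"
proof (cases "s \<in> \<nat>")
  case True
  then have mem: "u \<in> L2_space \<Omega>" "v \<in> L2_space \<Omega>"
    using u v by (auto simp: sobolev_space_def)
  have "\<exists>g\<in>L2_space \<Omega>. is_weak_deriv \<Omega> \<alpha> (\<lambda>x. u x + v x) g"
    if order: "real (multi_order \<alpha>) \<le> s" for \<alpha>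
  proof -
    obtain g h where "g \<in> L2_space \<Omega>" "is_weak_deriv \<Omega> \<alpha> u g"
      "h \<in> L2_space \<Omega>" "is_weak_deriv \<Omega> \<alpha> v h"
      using u v True order unfolding sobolev_space_def by simp blast
    then show ?thesis
      using is_weak_deriv_add[OF \<Omega> mem] L2_space_add by blast
  qed
  then show ?thesis
    using True mem by (auto simp: sobolev_space_def intro: L2_space_add)
next
  case False
  then obtain g h where "is_L2_fourier u g" "bessel_weight s g \<in> L2_space UNIV"
    "is_L2_fourier v h" "bessel_weight s h \<in> L2_space UNIV"
    and mem: "u \<in> L2_space UNIV" "v \<in> L2_space UNIV"
    using u v by (auto simp: sobolev_space_def)
  then have "is_L2_fourier (\<lambda>x. u x + v x) (\<lambda>x. g x + h x)"
    and "bessel_weight s (\<lambda>x. g x + h x) \<in> L2_space UNIV"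
    using is_L2_fourier_add[OF mem] L2_space_add[of "bessel_weight s g" UNIV "bessel_weight s h"]
    by (auto simp: bessel_weight_def[abs_def] distrib_left)
  then show ?thesis
    using False mem by (auto simp: sobolev_space_def intro: L2_space_add)
qed

lemma sobolev_space_scale:
  assumes u: "u \<in> sobolev_space \<Omega> s"
  shows "(\<lambda>x. c * u x) \<in> sobolev_space \<Omega> s"
proof (cases "s \<in> \<nat>")
  case True
  then show ?thesis
    using u unfolding sobolev_space_def
    by (auto intro: L2_space_scale) (blast intro: L2_space_scale is_weak_deriv_scale)
next
  case False
  then obtain g where "is_L2_fourier u g" "bessel_weight s g \<in> L2_space UNIV"
    and mem: "u \<in> L2_space UNIV"
    using u by (auto simp: sobolev_space_def)
  then have "is_L2_fourier (\<lambda>x. c * u x) (\<lambda>x. c * g x)"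
    and "bessel_weight s (\<lambda>x. c * g x) \<in> L2_space UNIV"
    using is_L2_fourier_scale L2_space_scale[of "bessel_weight s g" UNIV c]
    by (auto simp: bessel_weight_def[abs_def] mult.left_commute)
  then show ?thesis
    using False mem by (auto simp: sobolev_space_def intro: L2_space_scale)
qed

text \<open>The member \<open>f\<close> only serves to show that the space contains \<open>0\<close>, as \<open>0 \<cdot> f\<close>.\<close>

lemma function_inner_space_sobolev:
  assumes "open \<Omega>" "is_sobolev_inner \<Omega> s ip" "f \<in> sobolev_space \<Omega> s"
  shows "function_inner_space \<Omega> (sobolev_space \<Omega> s) ip"
proof
  show "(\<lambda>x. 0) \<in> sobolev_space \<Omega> s"
    using sobolev_space_scale[OF assms(3), of 0] by simp
qed (use assms in \<open>auto intro: sobolev_space_add sobolev_space_scale simp: is_sobolev_inner_def\<close>)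

section \<open>The finite-dimensional adjoint in coordinates\<close>

lemma matrix_inv_mult_left:
  assumes "invertible A"
  shows "matrix_inv A ** A = mat 1"
  using someI_ex[OF assms[unfolded invertible_def]] by (simp add: matrix_inv_def)

lemma eq_matrix_inv_mult_vec:
  fixes A :: "complex^'i^'i"
  assumes "invertible A" "A *v x = b"
  shows "x = matrix_inv A *v b"
  using assms(2)
  by (auto simp: matrix_vector_mul_assoc matrix_inv_mult_left[OF assms(1)] matrix_vector_mul_lid)

theorem proposition9p1:
  fixes \<Omega> :: "(real^'N) set" and s :: real
    and ip :: "(real^'N \<Rightarrow> complex) \<Rightarrow> (real^'N \<Rightarrow> complex) \<Rightarrow> complex"
    and \<phi> :: "'m::finite \<Rightarrow> real^'N \<Rightarrow> complex"
    and \<psi> :: "'n::finite \<Rightarrow> real^'N \<Rightarrow> complex"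
    and Estar P Q E_mn E_mn_star :: "(real^'N \<Rightarrow> complex) \<Rightarrow> real^'N \<Rightarrow> complex"
    and u :: "real^'N \<Rightarrow> complex"
    and H_X :: "complex^'m^'m" and H_Y :: "complex^'n^'n"
    and u_vec :: "complex^'n" and M :: "complex^'n^'m" and z :: "complex^'m"
  assumes "open \<Omega>" and "\<Omega> \<noteq> {}"
    and "0 \<le> s" and "s \<in> \<nat> \<or> \<Omega> = UNIV"
    and "is_sobolev_inner \<Omega> s ip"
    and "is_adjoint \<Omega> s ip sobolev_embedding Estar"
    and "\<And>k. \<phi> k \<in> sobolev_space \<Omega> s" and "lin_indep \<Omega> \<phi>"
    and "\<And>k. \<psi> k \<in> L2_space \<Omega>" and "lin_indep \<Omega> \<psi>"
    and "is_orth_proj (sobolev_space \<Omega> s) ip (fun_span \<Omega> (sobolev_space \<Omega> s) \<phi>) P"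
    and "is_orth_proj (L2_space \<Omega>) (L2_inner \<Omega>) (fun_span \<Omega> (L2_space \<Omega>) \<psi>) Q"
    and "E_mn = Q \<circ> sobolev_embedding \<circ> P"
    and "E_mn_star = P \<circ> Estar \<circ> Q"
    and "u \<in> L2_space \<Omega>"
    and "H_X = (\<chi> k j. ip (\<phi> j) (\<phi> k))"
    and "H_Y = (\<chi> k j. L2_inner \<Omega> (\<psi> j) (\<psi> k))"
    and "u_vec = (\<chi> j. L2_inner \<Omega> u (\<psi> j))"
    and "M = (\<chi> k j. L2_inner \<Omega> (\<psi> j) (\<phi> k))"
    and "z = (matrix_inv H_X ** M ** matrix_inv H_Y) *v u_vec"
  shows "is_adjoint \<Omega> s ip E_mn E_mn_star \<and>
         invertible H_X \<and> invertible H_Y \<and>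
         ae_eq \<Omega> (E_mn_star u) (\<lambda>x. \<Sum>k\<in>UNIV. z $ k * \<phi> k x)"
proof -
  let ?V = "sobolev_space \<Omega> s"
  note P = assms(11) and Q = assms(12)
  interpret H: function_inner_space \<Omega> ?V ip
    by (rule function_inner_space_sobolev[OF assms(1,5,7)])
  interpret L: function_inner_space \<Omega> "L2_space \<Omega>" "L2_inner \<Omega>"
    by (rule function_inner_space_L2)
  have sub: "?V \<subseteq> L2_space \<Omega>"
    by (rule sobolev_space_subset_L2[OF assms(4)])
  have Estar_mem: "Estar v \<in> ?V" if "v \<in> L2_space \<Omega>" for v
    using assms(6) that unfolding is_adjoint_def by blast
  have Estar: "ip (Estar v) w = L2_inner \<Omega> v w" if "v \<in> L2_space \<Omega>" "w \<in> ?V" for v w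
    using assms(6) that unfolding is_adjoint_def sobolev_embedding_def by blast
  note Q_mem = L.orth_proj_mem(2)[OF Q] and P_mem = H.orth_proj_mem(2)[OF P]

  have "ip (E_mn_star v) w = L2_inner \<Omega> v (E_mn w)" if v: "v \<in> L2_space \<Omega>" and w: "w \<in> ?V" for v w
  proof -
    have "ip (E_mn_star v) w = ip (Estar (Q v)) (P w)"
      using H.orth_proj_selfadjoint[OF P Estar_mem[OF Q_mem[OF v]] w] by (simp add: assms(14))
    also have "\<dots> = L2_inner \<Omega> (Q v) (P w)"
      by (rule Estar[OF Q_mem[OF v] P_mem[OF w]])
    also have "\<dots> = L2_inner \<Omega> v (E_mn w)"
      using L.orth_proj_selfadjoint[OF Q v, of "P w"] P_mem[OF w] sub
      by (auto simp: assms(13) sobolev_embedding_def)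
    finally show ?thesis .
  qed
  moreover have "E_mn_star v \<in> ?V" if "v \<in> L2_space \<Omega>" for v
    using P_mem[OF Estar_mem[OF Q_mem[OF that]]] by (simp add: assms(14))
  ultimately have adjoint: "is_adjoint \<Omega> s ip E_mn E_mn_star"
    unfolding is_adjoint_def by blast

  have inv: "invertible H_X" "invertible H_Y"
    unfolding assms(16,17)
    using H.invertible_Gram[OF assms(7,8)] L.invertible_Gram[OF assms(9,10)] by auto

  note Qu = Q_mem[OF assms(15)]
  obtain d where Qu_d: "ae_eq \<Omega> (Q u) (\<lambda>x. \<Sum>j\<in>UNIV. d $ j * \<psi> j x)"
    and H_Y_d: "H_Y *v d = u_vec"
    unfolding assms(17,18)
    by (rule L.orth_proj_normal_equations[OF Q assms(9) assms(15)])
  obtain c where c: "ae_eq \<Omega> (P (Estar (Q u))) (\<lambda>x. \<Sum>k\<in>UNIV. c $ k * \<phi> k x)"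
    and H_X_c: "H_X *v c = (\<chi> k. ip (Estar (Q u)) (\<phi> k))"
    unfolding assms(16)
    by (rule H.orth_proj_normal_equations[OF P assms(7) Estar_mem[OF Qu]])
  have "ip (Estar (Q u)) (\<phi> k) = (M *v d) $ k" for k
  proof -
    have \<phi>: "\<phi> k \<in> L2_space \<Omega>" using assms(7) sub by blast
    have "ip (Estar (Q u)) (\<phi> k) = L2_inner \<Omega> (Q u) (\<phi> k)"
      by (rule Estar[OF Qu assms(7)])
    also have "\<dots> = L2_inner \<Omega> (\<lambda>x. \<Sum>j\<in>UNIV. d $ j * \<psi> j x) (\<phi> k)"
      by (rule L.ip_cong[OF Qu _ \<phi> Qu_d]) (intro L.lincomb_mem assms(9), simp)
    also have "\<dots> = (\<Sum>j\<in>UNIV. d $ j * L2_inner \<Omega> (\<psi> j) (\<phi> k))"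
      by (intro L.ip_lincomb assms(9) \<phi>) simp
    also have "\<dots> = (M *v d) $ k"
      by (simp add: assms(19) matrix_vector_mult_def mult.commute)
    finally show ?thesis .
  qed
  then have H_X_c: "H_X *v c = M *v d"
    using H_X_c by (simp add: vec_eq_iff)
  have "d = matrix_inv H_Y *v u_vec"
    by (rule eq_matrix_inv_mult_vec[OF inv(2) H_Y_d])
  moreover have "c = matrix_inv H_X *v (M *v d)"
    by (rule eq_matrix_inv_mult_vec[OF inv(1) H_X_c])
  ultimately have "c = z"
    by (simp add: assms(20) matrix_vector_mul_assoc matrix_mul_assoc)
  with c have "ae_eq \<Omega> (E_mn_star u) (\<lambda>x. \<Sum>k\<in>UNIV. z $ k * \<phi> k x)"
    by (simp add: assms(14))
  with adjoint inv show ?thesis by blast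
qed

end
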